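(* Let $M$ be a complete convex surface of bounded specific curvature in $\mathbb{R}^3$, let $ABCD\subset M$ be a convex quadrilateral of perimeter less than $2\pi/\sqrt{K_1}$, and let $P_F$ be a point in the interior of $ABCD$ which also lies in the interior of the triangle $\triangle ABC$. Let $(w_R)_{ABCD}$, $R\in\{A,B,C,D\}$, be positive weights for which $P_F$ is the weighted Fermat-Torricelli point of $ABCD$. If $$\sum\nolimits_{ABCD}w=\sum\nolimits_{ABC}w=\sum\nolimits_{ABD}w=\sum\nolimits_{ACD}w=\sum\nolimits_{BCD}w,$$ then $$(w_i)_{ABCD}=a_i\,(w_D)_{ABCD}+b_i,\qquad i\in\{A,B,C\},$$ where $$a_A=\frac{\left(\frac{w_A}{w_D}\right)_{ACD}\left(\frac{w_B}{w_A}\right)_{ABC}+\left(\frac{w_A}{w_D}\right)_{ABD}\left(\frac{w_C}{w_A}\right)_{ABC}-1}{1+\left(\frac{w_B}{w_A}\right)_{ABC}+\left(\frac{w_C}{w_A}\right)_{ABC}},\qquad b_A=(w_A)_{ABC},$$ $$a_B=a_A\left(\frac{w_B}{w_A}\right)_{ABC}-\left(\frac{w_A}{w_D}\right)_{ACD}\left(\frac{w_B}{w_A}\right)_{ABC},\qquad b_B=(w_B)_{ABC},$$ $$a_C=a_A\left(\frac{w_C}{w_A}\right)_{ABC}-\left(\frac{w_A}{w_D}\right)_{ABD}\left(\frac{w_C}{w_A}\right)_{ABC},\qquad b_C=(w_C)_{ABC}.$$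
   Context: A convex surface is the whole boundary of a convex body in $\mathbb{R}^3$. For a domain $W$ on it, with curvature $\omega(W)=\iint_W K\,dS$ and area $S(W)$, the specific curvature is $\kappa(W)=\omega(W)/S(W)$. The surface $M$ is complete and has bounded specific curvature: there are constants $0<K_1<K_2$ with $K_1<\kappa(W)<K_2$ for domains $W$. A convex quadrilateral $ABCD$ has vertices $A,B,C,D$ in this cyclic order and sides that are shortest arcs. For positive weights $w_A,w_B,w_C,w_D$ attached to the vertices, a weighted Fermat-Torricelli point is a point $P_F$ of $M$ minimizing $f(P)=w_Al_A+w_Bl_B+w_Cl_C+w_Dl_D$, where $l_R$ is the length of the shortest arc from $P$ to the vertex $R$. Weights for which the given point $P_F$ is the minimizer are denoted $(w_R)_{ABCD}$. Let $u_R$ be the unit vector at $P_F$ tangent to the shortest arc $P_FR$ (the tangent cone at $P_F$ is a plane; the complete angle at $P_F$ is $2\pi$). For distinct $S,L,N\in\{A,B,C,D\}$, the numbers $(w_S)_{SLN},(w_L)_{SLN},(w_N)_{SLN}$ are a nonzero real solution of $(w_S)_{SLN}u_S+(w_L)_{SLN}u_L+(w_N)_{SLN}u_N=0$ (the 3-inverse weighted Fermat-Torricelli problem for $\triangle SLN$ at $P_F$), unique once their sum is prescribed. They are positive (for a positive sum) if $P_F$ is in the interior of $\triangle SLN$; otherwise some may be negative or zero. Write $\left(\frac{w_S}{w_L}\right)_{SLN}=(w_S)_{SLN}/(w_L)_{SLN}$. Notation for sums: $\sum_{ABCD}w=(w_A)_{ABCD}\left(1+\frac{w_B}{w_A}+\frac{w_C}{w_A}+\frac{w_D}{w_A}\right)_{ABCD}=(w_A)_{ABCD}+(w_B)_{ABCD}+(w_C)_{ABCD}+(w_D)_{ABCD}$,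 and $\sum_{SLN}w=(w_S)_{SLN}+(w_L)_{SLN}+(w_N)_{SLN}$. *)

theory Defs
  imports "HOL-Analysis.Analysis"
begin

section \<open>Convex surfaces and their specific curvature\<close>

text \<open>
  The body may be unbounded. It is closed, so its whole boundary is a closed subset of the space
  and hence a complete surface; completeness needs no separate clause.
\<close>

definition convex_body :: "(real^3) set \<Rightarrow> bool" where
  "convex_body G \<longleftrightarrow> closed G \<and> convex G \<and> interior G \<noteq> {}"

text \<open>
  Two-dimensional Hausdorff (outer) measure; the factor \<open>pi / 4\<close> makes it agree with the usual area
  on smooth surfaces. Boundedness is required because \<^const>\<open>diameter\<close> carries no information on
  unbounded sets.
\<close>

definition area_approx :: "real \<Rightarrow> (real^3) set \<Rightarrow> ennreal" where
  "area_approx \<delta> X =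
     (INF U \<in> {U :: nat \<Rightarrow> (real^3) set.
                 X \<subseteq> (\<Union>i. U i) \<and> (\<forall>i. bounded (U i) \<and> diameter (U i) \<le> \<delta>)}.
        (\<Sum>i. ennreal (pi / 4 * (diameter (U i))\<^sup>2)))"

definition area :: "(real^3) set \<Rightarrow> ennreal" where
  "area X = (SUP \<delta> \<in> {0<..}. area_approx \<delta> X)"

definition spherical_image :: "(real^3) set \<Rightarrow> (real^3) set \<Rightarrow> (real^3) set" where
  "spherical_image G W = {n. norm n = 1 \<and> (\<exists>x\<in>W. \<forall>y\<in>G. n \<bullet> (y - x) \<le> 0)}"

text \<open>
  The curvature of a part of a convex surface that need not be smooth is the area of its
  spherical image (Gauss, Alexandrov). Where the surface is smooth this is the integral of the
  Gaussian curvature; under bounded specific curvature it is absolutely continuous with respect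
  to area, and the Gaussian curvature is its density.
\<close>

definition curvature :: "(real^3) set \<Rightarrow> (real^3) set \<Rightarrow> ennreal" where
  "curvature G W = area (spherical_image G W)"

definition specific_curvature :: "(real^3) set \<Rightarrow> (real^3) set \<Rightarrow> ennreal" where
  "specific_curvature G W = curvature G W / area W"

definition surface_domain :: "(real^3) set \<Rightarrow> (real^3) set \<Rightarrow> bool" where
  "surface_domain M W \<longleftrightarrow> openin (top_of_set M) W \<and> connected W \<and> W \<noteq> {}"

definition bounded_specific_curvature :: "(real^3) set \<Rightarrow> real \<Rightarrow> real \<Rightarrow> bool" where
  "bounded_specific_curvature G K1 K2 \<longleftrightarrow>
     0 < K1 \<and> K1 < K2 \<and>
     (\<forall>W. surface_domain (frontier G) W \<longrightarrow>
        ennreal K1 < specific_curvature G W \<and> specific_curvature G W < ennreal K2)"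


section \<open>Intrinsic metric and shortest arcs\<close>

definition path_length :: "(real \<Rightarrow> 'a::metric_space) \<Rightarrow> ennreal" where
  "path_length g =
     (SUP (t, n) \<in> {(t :: nat \<Rightarrow> real, n :: nat). mono t \<and> range t \<subseteq> {0..1}}.
        (\<Sum>i<n. ennreal (dist (g (t i)) (g (t (Suc i))))))"

definition intrinsic_dist :: "'a::metric_space set \<Rightarrow> 'a \<Rightarrow> 'a \<Rightarrow> ennreal" where
  "intrinsic_dist M x y =
     (INF g \<in> {g. path g \<and> path_image g \<subseteq> M \<and> pathstart g = x \<and> pathfinish g = y}.
        path_length g)"

definition shortest_arc :: "'a::metric_space set \<Rightarrow> 'a \<Rightarrow> 'a \<Rightarrow> (real \<Rightarrow> 'a) \<Rightarrow> bool" where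
  "shortest_arc M x y g \<longleftrightarrow>
     arc g \<and> path_image g \<subseteq> M \<and> pathstart g = x \<and> pathfinish g = y \<and>
     path_length g < \<infinity> \<and> path_length g = intrinsic_dist M x y"

text \<open>
  Unit vector tangent to an arc at its starting point, as the limit of the directions of the
  chords, so that it does not depend on the parametrisation; recall
  \<^term>\<open>sgn v = v /\<^sub>R norm v\<close>.
\<close>

definition unit_tangent :: "(real \<Rightarrow> 'a::real_normed_vector) \<Rightarrow> 'a \<Rightarrow> bool" where
  "unit_tangent g u \<longleftrightarrow> ((\<lambda>t. sgn (g t - g 0)) \<longlongrightarrow> u) (at_right 0)"


section \<open>Geodesic polygons\<close>

text \<open>
  \<open>Q\<close> is a closed topological disc on \<open>M\<close> whose boundary is the simple closed curve \<open>c\<close>. On a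
  closed surface \<open>c\<close> bounds two such discs, so the disc is part of the data.
\<close>

definition disc_bounded_by :: "(real^3) set \<Rightarrow> (real \<Rightarrow> real^3) \<Rightarrow> (real^3) set \<Rightarrow> bool" where
  "disc_bounded_by M c Q \<longleftrightarrow>
     simple_path c \<and> pathfinish c = pathstart c \<and>
     Q \<subseteq> M \<and> Q homeomorphic (cball 0 1 :: (real^2) set) \<and>
     (top_of_set M) frontier_of Q = path_image c"

definition geodesically_convex :: "(real^3) set \<Rightarrow> (real^3) set \<Rightarrow> bool" where
  "geodesically_convex M Q \<longleftrightarrow>
     (\<forall>x\<in>Q. \<forall>y\<in>Q. x \<noteq> y \<longrightarrow> (\<exists>g. shortest_arc M x y g \<and> path_image g \<subseteq> Q))"

definition geodesic_triangle ::
  "(real^3) set \<Rightarrow> real^3 \<Rightarrow> real^3 \<Rightarrow> real^3 \<Rightarrow>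
   (real \<Rightarrow> real^3) \<Rightarrow> (real \<Rightarrow> real^3) \<Rightarrow> (real \<Rightarrow> real^3) \<Rightarrow> (real^3) set \<Rightarrow> bool" where
  "geodesic_triangle M a b c s1 s2 s3 T \<longleftrightarrow>
     shortest_arc M a b s1 \<and> shortest_arc M b c s2 \<and> shortest_arc M c a s3 \<and>
     disc_bounded_by M (s1 +++ s2 +++ s3) T"

definition convex_quadrilateral ::
  "(real^3) set \<Rightarrow> real^3 \<Rightarrow> real^3 \<Rightarrow> real^3 \<Rightarrow> real^3 \<Rightarrow>
   (real \<Rightarrow> real^3) \<Rightarrow> (real \<Rightarrow> real^3) \<Rightarrow> (real \<Rightarrow> real^3) \<Rightarrow> (real \<Rightarrow> real^3) \<Rightarrow>
   (real^3) set \<Rightarrow> bool" where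
  "convex_quadrilateral M a b c d s1 s2 s3 s4 Q \<longleftrightarrow>
     shortest_arc M a b s1 \<and> shortest_arc M b c s2 \<and>
     shortest_arc M c d s3 \<and> shortest_arc M d a s4 \<and>
     disc_bounded_by M (s1 +++ s2 +++ s3 +++ s4) Q \<and>
     geodesically_convex M Q"


section \<open>Weighted Fermat-Torricelli points and the inverse problem\<close>

datatype vertex = A | B | C | D

definition weighted_FT_point ::
  "(real^3) set \<Rightarrow> (vertex \<Rightarrow> real^3) \<Rightarrow> (vertex \<Rightarrow> real) \<Rightarrow> real^3 \<Rightarrow> bool" where
  "weighted_FT_point M V w P \<longleftrightarrow>
     P \<in> M \<and>
     (\<forall>X\<in>M. (\<Sum>R\<in>{A, B, C, D}. ennreal (w R) * intrinsic_dist M P (V R))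
           \<le> (\<Sum>R\<in>{A, B, C, D}. ennreal (w R) * intrinsic_dist M X (V R)))"

text \<open>
  \<open>v\<close> is the solution of the 3-inverse problem for the triple \<open>S\<close> of vertices: a nonzero real
  solution (components of any sign), unique once the sum of its components is prescribed.
  Values of \<open>v\<close> outside \<open>S\<close> are irrelevant.
\<close>

definition inverse_FT_weights ::
  "(vertex \<Rightarrow> 'a::real_vector) \<Rightarrow> vertex set \<Rightarrow> (vertex \<Rightarrow> real) \<Rightarrow> bool" where
  "inverse_FT_weights u S v \<longleftrightarrow>
     (\<Sum>R\<in>S. v R *\<^sub>R u R) = 0 \<and> (\<exists>R\<in>S. v R \<noteq> 0) \<and>
     (\<forall>v'. (\<Sum>R\<in>S. v' R *\<^sub>R u R) = 0 \<and> (\<Sum>R\<in>S. v' R) = (\<Sum>R\<in>S. v R)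
           \<longrightarrow> (\<forall>R\<in>S. v' R = v R))"

end

theory Submission
  imports Defs
begin

text \<open>
  The claim is linear algebra once the weights are known to be balanced at \<open>P\<close>, that is,
  \<open>w A *\<^sub>R u A + w B *\<^sub>R u B + w C *\<^sub>R u C + w D *\<^sub>R u D = 0\<close>. The relations between the four
  tangent vectors then form a plane, and those with a prescribed sum of coefficients form a line,
  parametrised by the coefficient at \<open>D\<close>. The solution for \<open>ABC\<close> is its point with parameter
  \<open>0\<close>, which explains the constant terms; the solutions for \<open>ACD\<close> and \<open>ABD\<close>, whose
  coefficients at \<open>B\<close> and at \<open>C\<close> vanish, determine the slopes
  (\<open>eliminate_fourth_vertex\<close>, \<open>solve_for_weights\<close>).

  The balance (\<open>weighted_FT_point_balanced\<close>) is the first-order condition for a minimum, and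
  it comes from competitors in a supporting plane that contains all \<open>u R\<close>. The three-vertex
  relations show that all \<open>u R\<close> lie in one plane, and their uniqueness shows that \<open>u A\<close>, \<open>u B\<close>, \<open>u C\<close> are different. Each
  \<open>u R\<close> is a boundary direction of the cone of directions from \<open>P\<close> into the interior of the
  body, and a plane through the interior of a convex cone contains only two boundary rays. Hence the
  plane of the \<open>u R\<close> misses the interior and lies in a supporting plane of the body at \<open>P\<close>
  (\<open>supporting_normal_orthogonal_to_tangents\<close>).

  For a displacement \<open>v\<close> in this supporting plane, the projection of \<open>P + t *\<^sub>R v\<close> to the
  surface has intrinsic distance at most \<open>L - t * (v \<bullet> u R) + o(t)\<close> from the vertex \<open>R\<close>, where
  \<open>L\<close> is the length of the shortest arc from \<open>P\<close> (\<open>first_variation_le\<close>). Indeed the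
  straight segment in the supporting plane towards a point of the arc avoids the interior of the
  body, and projection to a convex body does not increase lengths, so that it becomes a short curve
  on the surface. If the resultant of the weighted tangents were nonzero, taking it for \<open>v\<close>
  would decrease the weighted sum of distances.
\<close>

section \<open>Lengths of paths\<close>

lemma path_length_le_lipschitz:
  fixes g :: "real \<Rightarrow> 'a::metric_space"
  assumes L: "L \<ge> 0"
    and lip: "\<And>s t. 0 \<le> s \<Longrightarrow> s \<le> t \<Longrightarrow> t \<le> 1 \<Longrightarrow> dist (g s) (g t) \<le> L * (t - s)"
  shows "path_length g \<le> ennreal L"
  unfolding path_length_def
proof (rule SUP_least, clarify)
  fix t :: "nat \<Rightarrow> real" and n :: nat
  assume t: "mono t" "range t \<subseteq> {0..1}"
  have t01: "0 \<le> t i \<and> t i \<le> 1" for i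
    using t(2) by (auto simp: subset_iff)
  have "(\<Sum>i<n. ennreal (dist (g (t i)) (g (t (Suc i)))))
      \<le> (\<Sum>i<n. ennreal (L * (t (Suc i) - t i)))"
    by (intro sum_mono ennreal_leI lip) (use t01 monoD[OF t(1)] in auto)
  also have "\<dots> = ennreal (\<Sum>i<n. L * (t (Suc i) - t i))"
    by (rule sum_ennreal) (use L monoD[OF t(1), of "_" "Suc _"] in auto)
  also have "(\<Sum>i<n. L * (t (Suc i) - t i)) = L * (t n - t 0)"
    by (simp add: sum_distrib_left[symmetric] sum_lessThan_telescope)
  also have "ennreal (L * (t n - t 0)) \<le> ennreal L"
    using t01[of n] t01[of 0] L by (intro ennreal_leI mult_left_le) auto
  finally show "(\<Sum>i<n. ennreal (dist (g (t i)) (g (t (Suc i))))) \<le> ennreal L" .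
qed

text \<open>
  A partition of the join, clamped to either half, gives a partition of each piece. The one
  interval that straddles the junction is covered by the triangle inequality at the common point,
  so no refinement of the partition is necessary.
\<close>

lemma path_length_join_le:
  fixes g h :: "real \<Rightarrow> 'a::real_normed_vector"
  assumes gh: "pathfinish g = pathstart h"
  shows "path_length (g +++ h) \<le> path_length g + path_length h"
  unfolding path_length_def[of "g +++ h"]
proof (rule SUP_least, clarify)
  fix t :: "nat \<Rightarrow> real" and n :: nat
  assume t: "mono t" "range t \<subseteq> {0..1}"
  have t01: "0 \<le> t i \<and> t i \<le> 1" for i
    using t(2) by (auto simp: subset_iff)
  define a b where "a = (\<lambda>i. min 1 (2 * t i))" and "b = (\<lambda>i. max 0 (2 * t i - 1))"
  have tt: "t i \<le> t (Suc i)" for i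
    using t(1) by (simp add: monoD)
  have ab: "mono a" "range a \<subseteq> {0..1}" "mono b" "range b \<subseteq> {0..1}"
    using t01 t(1) unfolding a_def b_def mono_def by (force simp: min_def max_def)+
  have eq: "g 1 = h 0"
    using gh by (simp add: pathstart_def pathfinish_def)
  have step: "dist ((g +++ h) (t i)) ((g +++ h) (t (Suc i)))
      \<le> dist (g (a i)) (g (a (Suc i))) + dist (h (b i)) (h (b (Suc i)))" for i
  proof -
    consider "t (Suc i) \<le> 1/2" | "t i > 1/2" | "t i \<le> 1/2" "t (Suc i) > 1/2"
      by linarith
    then show ?thesis
    proof cases
      case 1
      then show ?thesis using tt[of i] by (simp add: joinpaths_def a_def b_def)
    next
      case 2
      then show ?thesis using tt[of i] by (simp add: joinpaths_def a_def b_def)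
    next
      case 3
      then show ?thesis
        using dist_triangle[of "g (2 * t i)" "h (2 * t (Suc i) - 1)" "g 1"] eq
        by (simp add: joinpaths_def a_def b_def)
    qed
  qed
  have "(\<Sum>i<n. ennreal (dist ((g +++ h) (t i)) ((g +++ h) (t (Suc i)))))
      \<le> (\<Sum>i<n. ennreal (dist (g (a i)) (g (a (Suc i)))) + ennreal (dist (h (b i)) (h (b (Suc i)))))"
    by (intro sum_mono) (use step in \<open>simp add: ennreal_plus[symmetric] ennreal_leI del: ennreal_plus\<close>)
  also have "\<dots> = (\<Sum>i<n. ennreal (dist (g (a i)) (g (a (Suc i)))))
      + (\<Sum>i<n. ennreal (dist (h (b i)) (h (b (Suc i)))))"
    by (rule sum.distrib)
  also have "\<dots> \<le> path_length g + path_length h"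
    unfolding path_length_def
    by (intro add_mono SUP_upper2[of "(a, n)"] SUP_upper2[of "(b, n)"]) (use ab in auto)
  finally show "(\<Sum>i<n. ennreal (dist ((g +++ h) (t i)) ((g +++ h) (t (Suc i)))))
      \<le> path_length g + path_length h" .
qed

text \<open>
  This replaces additivity of length along a shortest arc. Only the chord of the initial piece is
  counted, because the first variation compares distances with chords.
\<close>

lemma chord_plus_path_length_subpath_le:
  fixes g :: "real \<Rightarrow> 'a::real_normed_vector"
  assumes \<tau>: "\<tau> \<in> {0..1}"
  shows "ennreal (dist (g 0) (g \<tau>)) + path_length (subpath \<tau> 1 g) \<le> path_length g"
proof -
  let ?I = "{(t :: nat \<Rightarrow> real, n :: nat). mono t \<and> range t \<subseteq> {0..1}}"
  let ?S = "\<lambda>g (t, n). \<Sum>i<n. ennreal (dist (g (t i)) (g (t (Suc i))))"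
  have ne: "?I \<noteq> {}"
    by (auto intro!: exI[of _ "\<lambda>_. 0"] simp: mono_def)
  have "ennreal (dist (g 0) (g \<tau>)) + path_length (subpath \<tau> 1 g)
      = (SUP p\<in>?I. ennreal (dist (g 0) (g \<tau>)) + ?S (subpath \<tau> 1 g) p)"
    unfolding path_length_def by (rule ennreal_SUP_add_right[OF ne])
  also have "\<dots> \<le> path_length g"
  proof (rule SUP_least, clarify)
    fix t :: "nat \<Rightarrow> real" and n :: nat
    assume t: "mono t" "range t \<subseteq> {0..1}"
    have t01: "0 \<le> t i \<and> t i \<le> 1" for i
      using t(2) by (auto simp: subset_iff)
    \<comment> \<open>The partition of the whole path starts with \<open>0, \<tau>\<close>, so that the chord is its first term.\<close>
    define c where
      "c i = (case i of 0 \<Rightarrow> 0 | Suc 0 \<Rightarrow> \<tau> | Suc (Suc j) \<Rightarrow> (1 - \<tau>) * t j + \<tau>)" for i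
    have c: "c 0 = 0" "c (Suc 0) = \<tau>" "\<And>j. c (Suc (Suc j)) = (1 - \<tau>) * t j + \<tau>"
      by (auto simp: c_def)
    have c01: "c i \<in> {0..1}" for i
    proof -
      have "(1 - \<tau>) * t j + \<tau> \<le> 1" for j
        using mult_left_le[of "t j" "1 - \<tau>"] t01[of j] \<tau> by auto
      then show ?thesis
        using t01 \<tau> by (auto simp: c_def split: nat.splits)
    qed
    have "c i \<le> c (Suc i)" for i
    proof -
      have "(1 - \<tau>) * t j \<le> (1 - \<tau>) * t (Suc j)" for j
        using \<tau> monoD[OF t(1), of j "Suc j"] by (intro mult_left_mono) auto
      moreover have "0 \<le> (1 - \<tau>) * t 0"
        using \<tau> t01 by simp
      ultimately show ?thesis
        using \<tau> by (auto simp: c_def split: nat.splits)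
    qed
    then have "mono c"
      by (simp add: mono_iff_le_Suc)
    have "ennreal (dist (g 0) (g \<tau>))
        + (\<Sum>i<n. ennreal (dist (subpath \<tau> 1 g (t i)) (subpath \<tau> 1 g (t (Suc i)))))
      \<le> (\<Sum>i<Suc (Suc n). ennreal (dist (g (c i)) (g (c (Suc i)))))"
      unfolding sum.lessThan_Suc_shift by (simp add: c subpath_def add_mono)
    also have "\<dots> \<le> path_length g"
      unfolding path_length_def
      by (rule SUP_upper2[of "(c, Suc (Suc n))"]) (use \<open>mono c\<close> c01 in \<open>auto simp del: sum.lessThan_Suc\<close>)
    finally show "ennreal (dist (g 0) (g \<tau>))
        + (\<Sum>i<n. ennreal (dist (subpath \<tau> 1 g (t i)) (subpath \<tau> 1 g (t (Suc i)))))
      \<le> path_length g" .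
  qed
  finally show ?thesis .
qed

section \<open>Short curves on a convex surface\<close>

lemma closest_point_in_frontier:
  fixes G :: "'a::euclidean_space set"
  assumes G: "closed G" "convex G" "G \<noteq> {}" and q: "q \<notin> interior G"
  shows "closest_point G q \<in> frontier G"
proof (cases "q \<in> G")
  case True
  then show ?thesis
    using q G by (simp add: closest_point_self frontier_def)
next
  case False
  show ?thesis
  proof (cases "interior G = {}")
    case True
    then show ?thesis
      using G closest_point_in_set[of G q] by (simp add: frontier_def)
  next
    case ne: False
    then have "affine hull G = UNIV" "rel_interior G = interior G"
      by (simp_all add: affine_hull_nonempty_interior rel_interior_nonempty_interior)
    then show ?thesis
      using closest_point_in_rel_frontier[of G q] G q ne
      by (simp add: rel_frontier_nonempty_interior)
  qed
qed

text \<open>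
  The source of short curves on the surface: nearest-point projection to a convex set is
  1-Lipschitz, so a straight segment that avoids the interior is mapped to a curve on the boundary
  that is no longer than the segment.
\<close>

lemma projected_segment:
  fixes G :: "'a::euclidean_space set"
  assumes G: "closed G" "convex G" "G \<noteq> {}"
    and out: "closed_segment x y \<inter> interior G = {}"
  defines "p \<equiv> closest_point G \<circ> linepath x y"
  shows "path p" "path_image p \<subseteq> frontier G"
    and "pathstart p = closest_point G x" "pathfinish p = closest_point G y"
    and "path_length p \<le> ennreal (dist x y)"
proof -
  show "path p"
    unfolding p_def by (intro path_continuous_image continuous_on_closest_point G path_linepath)
  show "path_image p \<subseteq> frontier G"
    using out closest_point_in_frontier[OF G] by (auto simp: p_def path_image_compose)
  show "pathstart p = closest_point G x" "pathfinish p = closest_point G y"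
    by (simp_all add: p_def pathstart_compose pathfinish_compose)
  have "dist (p s) (p t) \<le> dist x y * (t - s)" if "s \<le> t" for s t
  proof -
    have "linepath x y s - linepath x y t = (t - s) *\<^sub>R (x - y)"
      by (simp add: linepath_def algebra_simps)
    then have "dist (linepath x y s) (linepath x y t) = dist x y * (t - s)"
      using that by (simp add: dist_norm)
    then show ?thesis
      using closest_point_lipschitz[OF G(2,1,3), of "linepath x y s" "linepath x y t"]
      by (simp add: p_def)
  qed
  then show "path_length p \<le> ennreal (dist x y)"
    by (intro path_length_le_lipschitz) auto
qed

text \<open>
  The competitor curve is the projection of the broken line from \<open>x\<close> over \<open>y\<close> to the
  point \<open>g \<tau>\<close>, continued along \<open>g\<close>. Compared with \<open>g\<close> itself it trades the
  chord from \<open>g 0\<close> to \<open>g \<tau>\<close> for the length of the broken line.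
\<close>

lemma intrinsic_dist_detour_le:
  fixes G :: "'a::euclidean_space set"
  assumes G: "closed G" "convex G"
    and g: "path g" "path_image g \<subseteq> frontier G" "\<tau> \<in> {0..1}"
    and out: "closed_segment x y \<inter> interior G = {}" "closed_segment y (g \<tau>) \<inter> interior G = {}"
  shows "intrinsic_dist (frontier G) (closest_point G x) (pathfinish g) + ennreal (dist (g 0) (g \<tau>))
      \<le> ennreal (dist x y + dist y (g \<tau>)) + path_length g"
proof -
  have gF: "g \<tau> \<in> frontier G"
    using g by (auto simp: path_image_def)
  then have gG: "g \<tau> \<in> G"
    using G by (auto simp: frontier_def)
  then have ne: "G \<noteq> {}"
    by auto
  define p q r where "p = closest_point G \<circ> linepath x y"
    and "q = closest_point G \<circ> linepath y (g \<tau>)" and "r = subpath \<tau> 1 g"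
  note p = projected_segment[OF G ne out(1), folded p_def]
  note q = projected_segment[OF G ne out(2), folded q_def]
  have r: "path r" "path_image r \<subseteq> frontier G" "pathstart r = g \<tau>"
    using g path_image_subpath_subset[of \<tau> 1 g] by (auto simp: r_def)
  have r1: "pathfinish r = pathfinish g"
    unfolding r_def pathfinish_subpath by (simp add: pathfinish_def)
  have qr: "pathfinish q = pathstart r"
    using q r gG by (simp add: closest_point_self)
  have "intrinsic_dist (frontier G) (closest_point G x) (pathfinish g) \<le> path_length (p +++ q +++ r)"
    unfolding intrinsic_dist_def
    by (rule INF_lower) (use p q r r1 qr in \<open>auto simp: path_image_join\<close>)
  also have "\<dots> \<le> path_length p + path_length (q +++ r)"
    by (rule path_length_join_le) (use p q in simp)
  also have "\<dots> \<le> path_length p + (path_length q + path_length r)"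
    by (intro add_left_mono path_length_join_le qr)
  also have "\<dots> \<le> ennreal (dist x y) + (ennreal (dist y (g \<tau>)) + path_length r)"
    by (intro add_mono p q order_refl)
  finally have "intrinsic_dist (frontier G) (closest_point G x) (pathfinish g)
      \<le> ennreal (dist x y + dist y (g \<tau>)) + path_length r"
    by (simp add: add.assoc)
  then have "intrinsic_dist (frontier G) (closest_point G x) (pathfinish g) + ennreal (dist (g 0) (g \<tau>))
      \<le> ennreal (dist x y + dist y (g \<tau>)) + (ennreal (dist (g 0) (g \<tau>)) + path_length r)"
    by (metis add.assoc add.commute add_right_mono)
  also have "\<dots> \<le> ennreal (dist x y + dist y (g \<tau>)) + path_length g"
    unfolding r_def by (intro add_left_mono chord_plus_path_length_subpath_le g)
  finally show ?thesis .
qed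

section \<open>Tangent directions and the first variation of distance\<close>

lemma norm_unit_tangent:
  assumes g: "inj_on g {0..1}" "unit_tangent g u"
  shows "norm u = 1"
proof -
  have "((\<lambda>t. norm (sgn (g t - g 0))) \<longlongrightarrow> norm u) (at_right 0)"
    using g(2) unfolding unit_tangent_def by (rule tendsto_norm)
  moreover have "\<forall>\<^sub>F t in at_right (0::real). norm (sgn (g t - g 0)) = 1"
    unfolding eventually_at_right_field
  proof (intro exI[of _ 1] conjI allI impI)
    fix t :: real assume "0 < t" "t < 1"
    then have "g t \<noteq> g 0"
      using inj_onD[OF g(1), of t 0] by auto
    then show "norm (sgn (g t - g 0)) = 1"
      by (simp add: norm_sgn)
  qed simp
  ultimately have "((\<lambda>t::real. 1::real) \<longlongrightarrow> norm u) (at_right 0)"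
    using tendsto_cong by fastforce
  then show ?thesis
    by (simp add: tendsto_const_iff)
qed

text \<open>
  Chords are indexed by their length \<open>s\<close> here, and not by the parameter of the path: chords
  of several arcs can then be compared at the same scale, whatever their parametrisations.
\<close>

lemma chord_near_tangent:
  assumes g: "path g" "inj_on g {0..1}" "unit_tangent g u" and \<eta>: "\<eta> > 0"
  shows "\<forall>\<^sub>F s in at_right 0. \<exists>\<tau>\<in>{0<..1}. dist (g 0) (g \<tau>) = s \<and> norm (g \<tau> - g 0 - s *\<^sub>R u) \<le> \<eta> * s"
proof -
  have "\<forall>\<^sub>F t in at_right 0. dist (sgn (g t - g 0)) u < \<eta>"
    using g(3) \<eta> unfolding unit_tangent_def by (rule tendstoD)
  then obtain b where b: "b > 0" "\<And>t. 0 < t \<Longrightarrow> t < b \<Longrightarrow> dist (sgn (g t - g 0)) u < \<eta>"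
    unfolding eventually_at_right_field by auto
  define c where "c = min 1 (b / 2)"
  have c: "0 < c" "c \<le> 1" "c < b"
    using b(1) by (auto simp: c_def)
  have cont: "continuous_on {0..c} (\<lambda>t. dist (g 0) (g t))"
    using continuous_on_subset[of "{0..1}" g "{0..c}"] g(1) c
    by (intro continuous_on_dist continuous_on_const) (auto simp: path_def)
  have pos: "dist (g 0) (g c) > 0"
    using inj_onD[OF g(2), of 0 c] c by auto
  show ?thesis
    unfolding eventually_at_right_field
  proof (intro exI[of _ "dist (g 0) (g c)"] conjI allI impI pos)
    fix s :: real assume s: "0 < s" "s < dist (g 0) (g c)"
    then obtain \<tau> where \<tau>: "0 \<le> \<tau>" "\<tau> \<le> c" "dist (g 0) (g \<tau>) = s"
      using IVT'[of "\<lambda>t. dist (g 0) (g t)" 0 s c] cont c by auto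
    have "\<tau> > 0"
      using \<tau> s by (cases "\<tau> = 0") auto
    have n: "norm (g \<tau> - g 0) = s"
      using \<tau>(3) by (simp add: dist_norm norm_minus_commute)
    then have "g \<tau> - g 0 - s *\<^sub>R u = s *\<^sub>R (sgn (g \<tau> - g 0) - u)"
      using s by (simp add: sgn_div_norm algebra_simps)
    then have "norm (g \<tau> - g 0 - s *\<^sub>R u) = s * dist (sgn (g \<tau> - g 0)) u"
      using s by (simp add: dist_norm)
    also have "\<dots> \<le> s * \<eta>"
      using b(2)[of \<tau>] \<open>\<tau> > 0\<close> \<tau> c s by (intro mult_left_mono) auto
    finally show "\<exists>\<tau>\<in>{0<..1}. dist (g 0) (g \<tau>) = s \<and> norm (g \<tau> - g 0 - s *\<^sub>R u) \<le> \<eta> * s"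
      using \<tau> c \<open>\<tau> > 0\<close> by (intro bexI[of _ \<tau>]) (auto simp: mult.commute)
  qed
qed

text \<open>
  The distance function of a far point: seen from distance \<open>N * t\<close> in direction \<open>u\<close>, a
  displacement \<open>t *\<^sub>R v\<close> changes the distance by \<open>- t * (v \<bullet> u)\<close>, up to an error that
  is small compared with \<open>t\<close> once \<open>N\<close> is large. The bound is
  \<open>2 * N * x \<le> x\<^sup>2 + N\<^sup>2\<close> for \<open>x = norm (v - N *\<^sub>R u)\<close>.
\<close>

lemma norm_diff_scaled_unit_le:
  fixes u v :: "'a::real_inner"
  assumes u: "norm u = 1" and N: "N > 0" and t: "t > 0"
  shows "norm (t *\<^sub>R v - (N * t) *\<^sub>R u) \<le> N * t + t * ((norm v)\<^sup>2 / (2 * N) - v \<bullet> u)"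
proof -
  let ?x = "norm (v - N *\<^sub>R u)"
  have "?x\<^sup>2 = (norm v)\<^sup>2 - 2 * N * (v \<bullet> u) + N\<^sup>2"
    using u unfolding power2_norm_eq_inner norm_eq_1
    by (simp add: inner_diff inner_commute power2_eq_square algebra_simps)
  moreover have "2 * N * ?x \<le> ?x\<^sup>2 + N\<^sup>2"
    using sum_squares_bound[of N ?x] by (simp add: algebra_simps)
  ultimately have "2 * N * ?x \<le> 2 * N * (N + ((norm v)\<^sup>2 / (2 * N) - v \<bullet> u))"
    using N by (simp add: algebra_simps power2_eq_square)
  then have "?x \<le> N + ((norm v)\<^sup>2 / (2 * N) - v \<bullet> u)"
    using N by simp
  then have "t * ?x \<le> t * (N + ((norm v)\<^sup>2 / (2 * N) - v \<bullet> u))"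
    using t by simp
  moreover have "t *\<^sub>R v - (N * t) *\<^sub>R u = t *\<^sub>R (v - N *\<^sub>R u)"
    by (simp add: algebra_simps)
  then have "norm (t *\<^sub>R v - (N * t) *\<^sub>R u) = t * ?x"
    using t by simp
  ultimately show ?thesis
    by (simp add: distrib_left mult.commute)
qed

text \<open>
  Otherwise \<open>y\<close> would lie on a segment between two interior points.
\<close>

lemma outside_beyond_frontier:
  fixes G :: "'a::euclidean_space set"
  assumes G: "closed G" "convex G" and z: "z \<in> interior G" and y: "y \<in> frontier G"
    and c: "c \<ge> 0"
  shows "y + c *\<^sub>R (y - z) \<notin> interior G"
proof
  assume *: "y + c *\<^sub>R (y - z) \<in> interior G"
  have "y \<in> interior G"
  proof (cases "c = 0")
    case True
    then show ?thesis using * by simp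
  next
    case False
    have "(y + c *\<^sub>R (y - z)) - (c / (1 + c)) *\<^sub>R ((y + c *\<^sub>R (y - z)) - z) \<in> interior G"
      by (rule mem_interior_convex_shrink[OF G(2) z])
        (use * interior_subset False c in \<open>auto simp: field_simps\<close>)
    also have "(y + c *\<^sub>R (y - z)) - z = (1 + c) *\<^sub>R (y - z)"
      by (simp add: algebra_simps)
    also have "(c / (1 + c)) *\<^sub>R ((1 + c) *\<^sub>R (y - z)) = c *\<^sub>R (y - z)"
      using c by simp
    finally show ?thesis by simp
  qed
  then show False
    using y by (simp add: frontier_def)
qed

lemma interior_below_supporting_plane:
  fixes G :: "'a::euclidean_space set"
  assumes n: "n \<noteq> 0" "\<And>y. y \<in> G \<Longrightarrow> n \<bullet> (y - P) \<le> 0" and z: "z \<in> interior G"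
  shows "n \<bullet> (z - P) < 0"
proof -
  have "G \<subseteq> {x. n \<bullet> x \<le> n \<bullet> P}"
    using n(2) by (auto simp: inner_diff_right)
  then have "interior G \<subseteq> {x. n \<bullet> x < n \<bullet> P}"
    using interior_mono interior_halfspace_le[OF n(1)] by blast
  then show ?thesis
    using z by (auto simp: inner_diff_right)
qed

text \<open>
  If \<open>u\<close> is parallel to the supporting plane, a boundary point \<open>y\<close> at distance
  \<open>s\<close> from \<open>P\<close> nearly in direction \<open>u\<close> lies only slightly below that plane. Moving
  \<open>y\<close> away from an interior point \<open>z\<close> reaches the plane after a distance that is small
  compared with \<open>s\<close>, and never re-enters the interior.
\<close>

lemma supporting_plane_near_tangent_chord:
  fixes G :: "'a::euclidean_space set"
  assumes G: "closed G" "convex G"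
    and n: "n \<noteq> 0" "\<And>y. y \<in> G \<Longrightarrow> n \<bullet> (y - P) \<le> 0"
    and z: "z \<in> interior G" and u: "n \<bullet> u = 0"
  obtains C r where "C \<ge> 0" "r > 0"
    and "\<And>y s \<eta>. y \<in> frontier G \<Longrightarrow> 0 < s \<Longrightarrow> s \<le> r \<Longrightarrow> \<eta> \<le> 1 \<Longrightarrow> norm (y - P) = s \<Longrightarrow>
        norm (y - P - s *\<^sub>R u) \<le> \<eta> * s \<Longrightarrow>
        \<exists>y'. n \<bullet> (y' - P) = 0 \<and> dist y' y \<le> C * \<eta> * s \<and> closed_segment y' y \<inter> interior G = {}"
proof -
  define h where "h = n \<bullet> (P - z)"
  have h: "h > 0"
    using interior_below_supporting_plane[OF n z] by (simp add: h_def inner_diff_right)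
  define C where "C = 2 * norm n * (norm (P - z) + 1) / h"
  define r where "r = min 1 (h / (2 * norm n))"
  show ?thesis
  proof (rule that[of C r])
    show "C \<ge> 0" "r > 0"
      using h n by (auto simp: C_def r_def)
    fix y s \<eta>
    assume y: "y \<in> frontier G" and s: "0 < s" "s \<le> r" "\<eta> \<le> 1" "norm (y - P) = s"
      and near: "norm (y - P - s *\<^sub>R u) \<le> \<eta> * s"
    \<comment> \<open>\<open>d\<close> and \<open>h\<close> are the depths of \<open>y\<close> and \<open>z\<close> below the plane, scaled by
      \<open>norm n\<close>.\<close>
    define d where "d = - (n \<bullet> (y - P))"
    have "y \<in> G"
      using y G by (auto simp: frontier_def)
    then have d0: "d \<ge> 0"
      using n(2) by (simp add: d_def)
    have "d = - (n \<bullet> (y - P - s *\<^sub>R u))"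
      using u by (simp add: d_def inner_diff_right)
    also have "\<dots> \<le> norm n * norm (y - P - s *\<^sub>R u)"
      using norm_cauchy_schwarz[of "- n" "y - P - s *\<^sub>R u"] by simp
    also have "\<dots> \<le> norm n * (\<eta> * s)"
      by (intro mult_left_mono near norm_ge_zero)
    finally have d: "d \<le> norm n * (\<eta> * s)" .
    have "norm n * (\<eta> * s) \<le> norm n * (1 * r)"
      by (intro mult_left_mono mult_mono) (use s in auto)
    also have "norm n * (1 * r) \<le> h / 2"
      using n(1) by (auto simp: r_def min_def field_simps)
    finally have dh: "d \<le> h / 2"
      using d by simp
    have nz: "n \<bullet> (y - z) = h - d"
      by (simp add: h_def d_def inner_diff_right)
    define c where "c = d / (h - d)"
    have hd: "h / 2 \<le> h - d" "0 < h - d"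
      using dh h by auto
    have c: "0 \<le> c"
      using d0 hd by (simp add: c_def)
    define y' where "y' = y + c *\<^sub>R (y - z)"
    have "y' - P = (y - P) + c *\<^sub>R (y - z)"
      by (simp add: y'_def)
    then have "n \<bullet> (y' - P) = n \<bullet> (y - P) + c * (n \<bullet> (y - z))"
      by (simp only: inner_add_right inner_scaleR_right)
    moreover have "n \<bullet> (y - P) = - d"
      by (simp add: d_def)
    moreover have "c * (h - d) = d"
      using hd by (simp add: c_def)
    ultimately have on: "n \<bullet> (y' - P) = 0"
      by (simp add: nz)
    have "c \<le> norm n * (\<eta> * s) / (h / 2)"
      unfolding c_def using d d0 hd h by (intro frac_le) auto
    moreover have "norm (y - z) \<le> norm (P - z) + 1"
      using norm_triangle_ineq[of "y - P" "P - z"] s by (simp add: r_def)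
    ultimately have "c * norm (y - z) \<le> (norm n * (\<eta> * s) / (h / 2)) * (norm (P - z) + 1)"
      using c by (intro mult_mono) auto
    also have "\<dots> = C * \<eta> * s"
      by (simp add: C_def)
    finally have dist: "dist y' y \<le> C * \<eta> * s"
      using c by (simp add: y'_def dist_norm)
    have "closed_segment y' y \<inter> interior G = {}"
    proof -
      have "x \<notin> interior G" if x: "x \<in> closed_segment y y'" for x
      proof -
        obtain e where "0 \<le> e" "x = (1 - e) *\<^sub>R y + e *\<^sub>R y'"
          using x by (auto simp: in_segment)
        then have "x = y + (e * c) *\<^sub>R (y - z)" "e * c \<ge> 0"
          using c by (auto simp: y'_def algebra_simps)
        then show ?thesis
          using outside_beyond_frontier[OF G z y] by simp
      qed
      then show ?thesis
        by (auto simp: closed_segment_commute)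
    qed
    then show "\<exists>y'. n \<bullet> (y' - P) = 0 \<and> dist y' y \<le> C * \<eta> * s \<and> closed_segment y' y \<inter> interior G = {}"
      using on dist by blast
  qed
qed

text \<open>
  The upper half of the first variation formula, for \<open>u\<close> and \<open>v\<close> parallel to a
  supporting plane at \<open>P\<close>. The competitor runs inside this plane from
  \<open>P + t *\<^sub>R v\<close> to a point above the arc at distance about \<open>N * t\<close> from \<open>P\<close>, drops
  to the arc, and follows it; everything is projected to the surface.
\<close>

lemma first_variation_le:
  fixes G :: "'a::euclidean_space set"
  assumes G: "closed G" "convex G" "interior G \<noteq> {}"
    and n: "n \<noteq> 0" "\<And>y. y \<in> G \<Longrightarrow> n \<bullet> (y - P) \<le> 0"
    and g: "shortest_arc (frontier G) P W g" "unit_tangent g u"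
    and orth: "n \<bullet> u = 0" "n \<bullet> v = 0" and \<epsilon>: "\<epsilon> > 0"
  shows "\<forall>\<^sub>F t in at_right 0.
    intrinsic_dist (frontier G) (closest_point G (P + t *\<^sub>R v)) W < \<infinity> \<and>
    enn2real (intrinsic_dist (frontier G) (closest_point G (P + t *\<^sub>R v)) W)
      \<le> enn2real (path_length g) + t * (\<epsilon> - v \<bullet> u)"
proof -
  obtain z where z: "z \<in> interior G"
    using G(3) by blast
  have arc: "arc g" "path g" "inj_on g {0..1}" and gM: "path_image g \<subseteq> frontier G"
    and g01: "g 0 = P" "pathfinish g = W" and fin: "path_length g < \<infinity>"
    using g(1) by (auto simp: shortest_arc_def arc_def pathstart_def)
  have u1: "norm u = 1"
    using norm_unit_tangent[OF arc(3) g(2)] .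
  obtain C r where C: "C \<ge> 0" and r: "r > 0"
    and reach: "\<And>y s \<eta>. y \<in> frontier G \<Longrightarrow> 0 < s \<Longrightarrow> s \<le> r \<Longrightarrow> \<eta> \<le> 1 \<Longrightarrow> norm (y - P) = s \<Longrightarrow>
        norm (y - P - s *\<^sub>R u) \<le> \<eta> * s \<Longrightarrow>
        \<exists>y'. n \<bullet> (y' - P) = 0 \<and> dist y' y \<le> C * \<eta> * s \<and> closed_segment y' y \<inter> interior G = {}"
    using supporting_plane_near_tangent_chord[OF G(1,2) n z orth(1)] by blast
  \<comment> \<open>\<open>N\<close> makes the quadratic term of the distance expansion at most \<open>\<epsilon> / 2\<close>, and then
    \<open>\<eta>\<close> the total deviation of the chord from its tangent at scale \<open>N * t\<close>.\<close>
  define N where "N = (norm v)\<^sup>2 / \<epsilon> + 1"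
  have N: "N > 0"
    using \<epsilon> by (simp add: N_def add_nonneg_pos)
  have Nv: "(norm v)\<^sup>2 / (2 * N) \<le> \<epsilon> / 2"
    using \<epsilon> N by (simp add: N_def field_simps)
  define \<eta> where "\<eta> = min 1 (\<epsilon> / (2 * N * (1 + 2 * C)))"
  have \<eta>: "\<eta> > 0" "\<eta> \<le> 1"
    using \<epsilon> N C by (auto simp: \<eta>_def)
  have "\<eta> \<le> \<epsilon> / (2 * N * (1 + 2 * C))"
    by (simp add: \<eta>_def)
  then have \<eta>N: "(1 + 2 * C) * \<eta> * N \<le> \<epsilon> / 2"
    using N C by (simp add: pos_le_divide_eq mult_ac)
  obtain b where b: "b > 0" and chord: "\<And>s. 0 < s \<Longrightarrow> s < b \<Longrightarrow>
      \<exists>\<tau>\<in>{0<..1}. dist (g 0) (g \<tau>) = s \<and> norm (g \<tau> - g 0 - s *\<^sub>R u) \<le> \<eta> * s"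
    using chord_near_tangent[OF arc(2,3) g(2) \<eta>(1)] unfolding eventually_at_right_field by auto
  define t0 where "t0 = min b r / N"
  have t0: "t0 > 0"
    using b r N by (simp add: t0_def)
  show ?thesis
    unfolding eventually_at_right_field
  proof (intro exI[of _ t0] conjI[OF t0] allI impI)
    fix t :: real assume t: "0 < t" "t < t0"
    define s where "s = N * t"
    have s: "0 < s" "s < b" "s < r"
      using t N by (auto simp: s_def t0_def field_simps)
    obtain \<tau> where \<tau>: "\<tau> \<in> {0<..1}" "dist (g 0) (g \<tau>) = s" "norm (g \<tau> - g 0 - s *\<^sub>R u) \<le> \<eta> * s"
      using chord s by blast
    define y where "y = g \<tau>"
    have yM: "y \<in> frontier G"
      using gM \<tau> by (auto simp: y_def path_image_def)
    have ny: "norm (y - P) = s" "norm (y - P - s *\<^sub>R u) \<le> \<eta> * s"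
      using \<tau> g01 by (auto simp: y_def dist_norm norm_minus_commute)
    obtain y' where y': "n \<bullet> (y' - P) = 0" "dist y' y \<le> C * \<eta> * s"
      "closed_segment y' y \<inter> interior G = {}"
      using reach[OF yM s(1) _ \<eta>(2) ny] s by auto
    define x where "x = P + t *\<^sub>R v"
    have "closed_segment x y' \<subseteq> {q. n \<bullet> q = n \<bullet> P}"
      by (rule closed_segment_subset)
        (use y' orth in \<open>auto simp: x_def inner_diff_right inner_add_right convex_hyperplane\<close>)
    then have out: "closed_segment x y' \<inter> interior G = {}"
      using interior_below_supporting_plane[OF n] by (fastforce simp: inner_diff_right)
    let ?d = "intrinsic_dist (frontier G) (closest_point G x) W"
    let ?L = "enn2real (path_length g)"
    have L: "path_length g = ennreal ?L"
      using fin by (simp add: less_top)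
    have "?d + ennreal s \<le> ennreal (dist x y' + dist y' y) + path_length g"
      using intrinsic_dist_detour_le[OF G(1,2) arc(2) gM _ out y'(3)[unfolded y_def]] \<tau> g01
      by (simp add: y_def)
    then have le: "?d + ennreal s \<le> ennreal (dist x y' + dist y' y + ?L)"
      by (subst (asm) L) (simp add: ennreal_plus[symmetric] del: ennreal_plus)
    then have fd: "?d < \<infinity>"
      by (metis ennreal_add_eq_top ennreal_less_top infinity_ennreal_def le_less_trans less_top)
    then have D: "?d = ennreal (enn2real ?d)"
      by (simp add: less_top)
    have "ennreal (enn2real ?d + s) \<le> ennreal (dist x y' + dist y' y + ?L)"
      using le D s by (metis ennreal_plus enn2real_nonneg less_imp_le)
    then have "enn2real ?d + s \<le> dist x y' + dist y' y + ?L"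
      by (subst (asm) ennreal_le_iff) auto
    moreover have "dist x y' \<le> norm (t *\<^sub>R v - s *\<^sub>R u) + \<eta> * s + C * \<eta> * s"
    proof -
      have eq: "x - y' = (t *\<^sub>R v - s *\<^sub>R u) - (y - P - s *\<^sub>R u) - (y' - y)"
        by (simp add: x_def)
      have "dist x y' \<le> norm (t *\<^sub>R v - s *\<^sub>R u) + norm (y - P - s *\<^sub>R u) + norm (y' - y)"
        using norm_triangle_ineq4[of "(t *\<^sub>R v - s *\<^sub>R u) - (y - P - s *\<^sub>R u)" "y' - y"]
          norm_triangle_ineq4[of "t *\<^sub>R v - s *\<^sub>R u" "y - P - s *\<^sub>R u"]
        unfolding dist_norm eq by linarith
      then show ?thesis
        using ny y'(2) by (simp add: dist_norm)
    qed
    moreover have "norm (t *\<^sub>R v - s *\<^sub>R u) \<le> s + t * ((norm v)\<^sup>2 / (2 * N) - v \<bullet> u)"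
      unfolding s_def by (rule norm_diff_scaled_unit_le[OF u1 N t(1)])
    ultimately have "enn2real ?d
        \<le> ?L + t * ((norm v)\<^sup>2 / (2 * N) - v \<bullet> u) + (1 + 2 * C) * \<eta> * N * t"
      using y'(2) by (simp add: s_def algebra_simps)
    also have "\<dots> \<le> ?L + t * (\<epsilon> / 2 - v \<bullet> u) + \<epsilon> / 2 * t"
      using Nv \<eta>N t by (intro add_mono mult_left_mono mult_right_mono) auto
    finally show "?d < \<infinity> \<and> enn2real ?d \<le> ?L + t * (\<epsilon> - v \<bullet> u)"
      using fd by (simp add: algebra_simps)
  qed
qed

section \<open>Supporting planes containing given tangent directions\<close>

text \<open>
  Up to a positive factor the combination is a point of the segment from \<open>a\<close> to the interior
  point \<open>e\<close>, other than \<open>a\<close> itself, and such points are interior.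
\<close>

lemma open_convex_cone_absorbs_closure:
  fixes K :: "'a::euclidean_space set"
  assumes K: "open K" "convex K" "\<And>c x. c > 0 \<Longrightarrow> x \<in> K \<Longrightarrow> c *\<^sub>R x \<in> K"
    and a: "a \<in> closure K" and e: "e \<in> K" and coeff: "\<alpha> \<ge> 0" "\<beta> > 0"
  shows "\<alpha> *\<^sub>R a + \<beta> *\<^sub>R e \<in> K"
proof -
  have int: "interior K = K"
    using K(1) by (rule interior_open)
  let ?m = "\<beta> / (\<alpha> + \<beta>)"
  have "a - ?m *\<^sub>R (a - e) \<in> interior K"
    by (rule mem_interior_closure_convex_shrink[OF K(2) _ a]) (use int e coeff in auto)
  then have "(\<alpha> + \<beta>) *\<^sub>R (a - ?m *\<^sub>R (a - e)) \<in> K"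
    using K(3) coeff int by simp
  also have "(\<alpha> + \<beta>) *\<^sub>R (a - ?m *\<^sub>R (a - e)) = (\<alpha> + \<beta>) *\<^sub>R a - \<beta> *\<^sub>R (a - e)"
    using coeff by (simp add: scaleR_diff_right)
  also have "\<dots> = \<alpha> *\<^sub>R a + \<beta> *\<^sub>R e"
    by (simp add: algebra_simps)
  finally show ?thesis .
qed

text \<open>
  A plane that meets the open cone cuts it in an angular sector, whose boundary consists of only
  two rays. In coordinates: if \<open>e\<close> is a direction of the plane inside the cone, two different
  boundary rays lie strictly on opposite sides of the line spanned by \<open>e\<close>, and three rays
  cannot do so pairwise.
\<close>

lemma plane_with_three_boundary_rays_misses_cone:
  fixes K :: "'a::euclidean_space set"
  assumes K: "open K" "convex K" "\<And>c x. c > 0 \<Longrightarrow> x \<in> K \<Longrightarrow> c *\<^sub>R x \<in> K"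
    and S: "subspace S" "dim S \<le> 2"
    and U: "U \<subseteq> S" "U \<subseteq> closure K - K" "\<And>x. x \<in> U \<Longrightarrow> norm x = 1"
    and three: "a \<in> U" "b \<in> U" "c \<in> U" "a \<noteq> b" "a \<noteq> c" "b \<noteq> c"
  shows "S \<inter> K = {}"
proof (rule ccontr)
  assume "S \<inter> K \<noteq> {}"
  then obtain e where e: "e \<in> S" "e \<in> K"
    by blast
  note absorb = open_convex_cone_absorbs_closure[OF K _ e(2)]
  \<comment> \<open>A boundary direction on the line of \<open>e\<close> would itself be absorbed into the cone.\<close>
  have off_line: "x \<noteq> k *\<^sub>R e" if "x \<in> U" for x k
  proof
    assume x: "x = k *\<^sub>R e"
    show False
    proof (cases "k > 0")
      case True
      then show False using K(3) e that U(2) x by blast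
    next
      case False
      moreover have "x \<noteq> 0"
        using U(3)[OF that] by auto
      ultimately have k: "k < 0"
        using x by (cases "k = 0") auto
      have "2 *\<^sub>R x + (- k) *\<^sub>R e \<in> K"
        using k that U(2) by (intro absorb) auto
      also have "2 *\<^sub>R x + (- k) *\<^sub>R e = x"
        by (simp add: x algebra_simps flip: scaleR_left.add)
      finally show False
        using that U(2) by auto
    qed
  qed
  have opposite: "\<exists>p q. p < 0 \<and> y = p *\<^sub>R x + q *\<^sub>R e" if xy: "x \<in> U" "y \<in> U" "x \<noteq> y" for x y
  proof -
    have "independent {x, e}"
    proof -
      have "e \<noteq> 0"
        using absorb[of x 1 1] xy(1) U(2) by auto
      have "x \<notin> span {e}"
        using off_line[OF xy(1)] by (auto simp: span_singleton)
      then show ?thesis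
        using \<open>e \<noteq> 0\<close> by (simp add: independent_insert)
    qed
    moreover have "x \<noteq> e"
      using off_line[OF xy(1), of 1] by simp
    ultimately have "S \<subseteq> span {x, e}"
      using S U(1) e(1) xy(1) by (intro card_ge_dim_independent) auto
    then have "y \<in> span {x, e}"
      using U(1) xy(2) by auto
    then obtain p q where y: "y = p *\<^sub>R x + q *\<^sub>R e"
      by (auto simp: span_insert span_singleton algebra_simps)
    have "p < 0"
    proof (rule ccontr)
      assume "\<not> p < 0"
      moreover have "p \<noteq> 0"
        using off_line[OF xy(2), of q] y by auto
      ultimately have p: "p > 0" by simp
      consider "q > 0" | "q = 0" | "q < 0" by linarith
      then show False
      proof cases
        case 1
        then show False
          using absorb[of x p q] p xy U(2) y by auto
      next
        case 2
        then have "y = p *\<^sub>R x"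
          using y by simp
        moreover have "p = 1"
          using calculation U(3)[OF xy(1)] U(3)[OF xy(2)] p by simp
        ultimately show False
          using xy(3) by simp
      next
        case 3
        have "(1 / p) *\<^sub>R y + (- q / p) *\<^sub>R e \<in> K"
          using absorb[of y "1 / p" "- q / p"] p 3 xy U(2) by (auto simp: divide_neg_pos)
        also have "(1 / p) *\<^sub>R y + (- q / p) *\<^sub>R e = x"
          using p by (simp add: y scaleR_add_right)
        finally show False
          using xy(1) U(2) by auto
      qed
    qed
    then show ?thesis using y by blast
  qed
  obtain p q where b: "p < 0" "b = p *\<^sub>R a + q *\<^sub>R e"
    using opposite three by blast
  obtain p' q' where c: "p' < 0" "c = p' *\<^sub>R b + q' *\<^sub>R e"
    using opposite three by blast
  obtain p'' q'' where a: "p'' < 0" "a = p'' *\<^sub>R c + q'' *\<^sub>R e"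
    using opposite three by blast
  have "a = (p'' * p' * p) *\<^sub>R a + (p'' * p' * q + p'' * q' + q'') *\<^sub>R e"
    by (subst a(2), subst c(2), subst b(2)) (simp add: algebra_simps)
  then have "(1 - p'' * p' * p) *\<^sub>R a = (p'' * p' * q + p'' * q' + q'') *\<^sub>R e"
    by (simp add: scaleR_diff_left) (metis add_diff_cancel_left')
  moreover have "p'' * p' * p < 0"
    using a(1) b(1) c(1) by (simp add: mult_neg_neg mult_pos_neg)
  ultimately have "a = ((p'' * p' * q + p'' * q' + q'') / (1 - p'' * p' * p)) *\<^sub>R e"
    by (metis (no_types, lifting) less_irrefl diff_gt_0_iff_gt divide_inverse_commute less_trans
        scaleR_left_imp_eq scaleR_one scaleR_scaleR left_inverse zero_less_one)
  then show False
    using off_line three(1) by blast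
qed

text \<open>
  Tangent directions of curves on the surface are boundary directions of the cone \<open>K\<close> of
  directions that point from \<open>P\<close> into the interior of \<open>G\<close>. Three of them in one plane
  force this plane to miss \<open>K\<close>; a hyperplane that separates the two is the supporting
  plane.
\<close>

lemma supporting_normal_orthogonal_to_tangents:
  fixes G :: "'a::euclidean_space set"
  assumes G: "closed G" "convex G" "interior G \<noteq> {}" and P: "P \<in> frontier G"
    and g: "\<And>R. R \<in> I \<Longrightarrow> inj_on (g R) {0..1}" "\<And>R. R \<in> I \<Longrightarrow> g R 0 = P"
      "\<And>R. R \<in> I \<Longrightarrow> path_image (g R) \<subseteq> frontier G" "\<And>R. R \<in> I \<Longrightarrow> unit_tangent (g R) (u R)"
      "\<And>R. R \<in> I \<Longrightarrow> path (g R)"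
    and dim: "dim (span (u ` I)) \<le> 2"
    and three: "a \<in> I" "b \<in> I" "c \<in> I" "u a \<noteq> u b" "u a \<noteq> u c" "u b \<noteq> u c"
  obtains n where "n \<noteq> 0" "\<And>y. y \<in> G \<Longrightarrow> n \<bullet> (y - P) \<le> 0" "\<And>x. x \<in> span (u ` I) \<Longrightarrow> n \<bullet> x = 0"
proof -
  define K where "K = {d. \<exists>s>0. P + s *\<^sub>R d \<in> interior G}"
  have PG: "P \<in> G" "P \<notin> interior G"
    using P G by (auto simp: frontier_def)
  have cone: "k *\<^sub>R x \<in> K" if k: "k > 0" and x: "x \<in> K" for k x
  proof -
    obtain s where "s > 0" "P + s *\<^sub>R x \<in> interior G"
      using x by (auto simp: K_def)
    then show ?thesis
      unfolding K_def using k by (auto intro!: exI[of _ "s / k"])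
  qed
  have openK: "open K"
  proof -
    have "K = (\<Union>s\<in>{0<..}. (\<lambda>d. P + s *\<^sub>R d) -` interior G)"
      by (auto simp: K_def)
    moreover have "open ((\<lambda>d. P + s *\<^sub>R d) -` interior G)" for s
      by (intro open_vimage open_interior continuous_intros)
    ultimately show ?thesis
      by auto
  qed
  have convexK: "convex K"
  proof (rule convexI)
    fix x y :: 'a and \<mu> \<nu> :: real
    assume x: "x \<in> K" and y: "y \<in> K" and \<mu>\<nu>: "0 \<le> \<mu>" "0 \<le> \<nu>" "\<mu> + \<nu> = 1"
    obtain s r where s: "s > 0" "P + s *\<^sub>R x \<in> interior G" and r: "r > 0" "P + r *\<^sub>R y \<in> interior G"
      using x y by (auto simp: K_def)
    define \<sigma> where "\<sigma> = \<mu> / s + \<nu> / r"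
    have \<sigma>: "\<sigma> > 0"
      using \<mu>\<nu> s r by (cases "\<mu> = 0") (auto simp: \<sigma>_def intro: add_pos_nonneg)
    have "(\<mu> / s / \<sigma>) *\<^sub>R (P + s *\<^sub>R x) + (\<nu> / r / \<sigma>) *\<^sub>R (P + r *\<^sub>R y) \<in> interior G"
    proof (rule convexD[OF convex_interior[OF G(2)] s(2) r(2)])
      show "\<mu> / s / \<sigma> + \<nu> / r / \<sigma> = 1"
        using \<sigma> unfolding add_divide_distrib[symmetric] by (simp add: \<sigma>_def)
    qed (use \<mu>\<nu> s r \<sigma> in auto)
    also have "(\<mu> / s / \<sigma>) *\<^sub>R (P + s *\<^sub>R x) + (\<nu> / r / \<sigma>) *\<^sub>R (P + r *\<^sub>R y)
        = ((\<mu> / s + \<nu> / r) / \<sigma>) *\<^sub>R P + (1 / \<sigma>) *\<^sub>R (\<mu> *\<^sub>R x + \<nu> *\<^sub>R y)"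
      using s r by (simp add: algebra_simps add_divide_distrib)
    also have "(\<mu> / s + \<nu> / r) / \<sigma> = 1"
      using \<sigma> by (simp add: \<sigma>_def)
    finally show "\<mu> *\<^sub>R x + \<nu> *\<^sub>R y \<in> K"
      unfolding K_def using \<sigma> by (auto intro!: exI[of _ "1 / \<sigma>"])
  qed
  have closureK: "y - P \<in> closure K" if "y \<in> G" for y
  proof -
    have "(\<lambda>y. y - P) ` interior G \<subseteq> closure K"
      using closure_subset[of K] by (auto simp: K_def intro!: subsetD[OF closure_subset[of K]] exI[of _ 1])
    then have "(\<lambda>y. y - P) ` closure (interior G) \<subseteq> closure K"
      by (intro image_closure_subset continuous_intros closed_closure)
    moreover have "closure (interior G) = G"
      using convex_closure_interior[OF G(2,3)] G(1) by simp
    ultimately show ?thesis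
      using that by blast
  qed
  have cone_closure: "k *\<^sub>R x \<in> closure K" if "k > 0" "x \<in> closure K" for k x
  proof -
    have "(\<lambda>x. k *\<^sub>R x) ` K \<subseteq> closure K"
      using cone that(1) closure_subset[of K] by auto
    then have "(\<lambda>x. k *\<^sub>R x) ` closure K \<subseteq> closure K"
      by (intro image_closure_subset continuous_intros closed_closure)
    then show ?thesis
      using that by blast
  qed
  have boundary: "u R \<in> closure K - K" if R: "R \<in> I" for R
  proof
    have lim: "((\<lambda>t. sgn (g R t - P)) \<longlongrightarrow> u R) (at_right 0)"
      using g(4)[OF R] g(2)[OF R] by (simp add: unit_tangent_def)
    have on: "g R t \<in> frontier G" "g R t \<noteq> P" if "0 < t" "t < 1" for t
      using g(3)[OF R] inj_onD[OF g(1)[OF R], of t 0] g(2)[OF R] that by (auto simp: path_image_def)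
    have ev: "\<forall>\<^sub>F t in at_right (0::real). 0 < t \<and> t < 1"
      unfolding eventually_at_right_field by (rule exI[of _ 1]) auto
    show "u R \<in> closure K"
    proof (rule Lim_in_closed_set[OF closed_closure _ _ lim])
      show "\<forall>\<^sub>F t in at_right 0. sgn (g R t - P) \<in> closure K"
        using ev
      proof eventually_elim
        case (elim t)
        then have "g R t \<in> G" "g R t \<noteq> P"
          using on G(1) by (auto simp: frontier_def)
        then show ?case
          using cone_closure[OF _ closureK] by (simp add: sgn_div_norm)
      qed
    qed simp
    show "u R \<notin> K"
    proof
      assume "u R \<in> K"
      then obtain s where s: "s > 0" "P + s *\<^sub>R u R \<in> interior G"
        by (auto simp: K_def)
      \<comment> \<open>Points of the curve close to \<open>P\<close> lie strictly between \<open>P\<close> and an interior point,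
        hence in the interior, although the curve runs on the frontier.\<close>
      have "((\<lambda>t. P + s *\<^sub>R sgn (g R t - P)) \<longlongrightarrow> P + s *\<^sub>R u R) (at_right 0)"
        by (intro tendsto_intros lim)
      then have "\<forall>\<^sub>F t in at_right 0. P + s *\<^sub>R sgn (g R t - P) \<in> interior G"
        using s(2) open_interior topological_tendstoD by blast
      moreover have "\<forall>\<^sub>F t in at_right 0. dist (g R t) P < s"
      proof -
        have "continuous (at_right 0) (g R)"
          using g(5)[OF R] by (auto simp: path_def continuous_on_eq_continuous_within
              at_within_Icc_at_right dest: bspec[of _ _ 0])
        then have "((g R) \<longlongrightarrow> P) (at_right 0)"
          using g(2)[OF R] by (simp add: continuous_within)
        then show ?thesis
          using s(1) by (rule tendstoD)
      qed
      ultimately have "\<forall>\<^sub>F t in at_right (0::real). False"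
        using ev
      proof eventually_elim
        case (elim t)
        define m where "m = dist (g R t) P / s"
        have m: "0 < m" "m < 1"
          using elim on s by (auto simp: m_def)
        have "P - m *\<^sub>R (P - (P + s *\<^sub>R sgn (g R t - P))) \<in> interior G"
          by (rule mem_interior_convex_shrink[OF G(2) elim(1) PG(1)]) (use m in auto)
        also have "P - m *\<^sub>R (P - (P + s *\<^sub>R sgn (g R t - P))) = g R t"
          using on elim s by (simp add: m_def sgn_div_norm dist_norm)
        finally show False
          using on elim by (simp add: frontier_def)
      qed
      then show False
        by simp
    qed
  qed
  have "norm (u R) = 1" if "R \<in> I" for R
    using norm_unit_tangent g that by blast
  then have disj: "span (u ` I) \<inter> K = {}"
    by (intro plane_with_three_boundary_rays_misses_cone[OF openK convexK cone subspace_span dim,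
        where U = "u ` I" and a = "u a" and b = "u b" and c = "u c"])
      (use boundary three in \<open>auto simp: span_base\<close>)
  obtain z where z: "z \<in> interior G"
    using G(3) by blast
  have inK: "k *\<^sub>R (y - P) \<in> K" if "k > 0" "y \<in> interior G" for k y
    by (rule cone) (use that in \<open>auto simp: K_def intro!: exI[of _ 1]\<close>)
  obtain n \<beta> where n: "n \<noteq> 0" and below: "\<And>x. x \<in> K \<Longrightarrow> n \<bullet> x \<le> \<beta>"
    and above: "\<And>x. x \<in> span (u ` I) \<Longrightarrow> n \<bullet> x \<ge> \<beta>"
    using separating_hyperplane_sets[of K "span (u ` I)"] convexK disj inK[of 1] z
      subspace_imp_convex[OF subspace_span] span_zero
    by (metis Int_commute empty_iff zero_less_one)
  have "\<beta> \<le> 0"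
    using above[OF span_zero] by simp
  show ?thesis
  proof (rule that[OF n])
    have "n \<bullet> (y - P) \<le> 0" if "y \<in> interior G" for y
      using below[OF inK[OF zero_less_one that]] \<open>\<beta> \<le> 0\<close> by simp
    then have "interior G \<subseteq> {y. n \<bullet> y \<le> n \<bullet> P}"
      by (auto simp: inner_diff_right)
    then have "closure (interior G) \<subseteq> {y. n \<bullet> y \<le> n \<bullet> P}"
      by (rule closure_minimal) (rule closed_halfspace_le)
    moreover have "closure (interior G) = G"
      using convex_closure_interior[OF G(2,3)] G(1) by simp
    ultimately show "n \<bullet> (y - P) \<le> 0" if "y \<in> G" for y
      using that by (auto simp: inner_diff_right)
    fix x assume x: "x \<in> span (u ` I)"
    show "n \<bullet> x = 0"
    proof (rule ccontr)
      assume "n \<bullet> x \<noteq> 0"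
      then have "n \<bullet> (((\<beta> - 1) / (n \<bullet> x)) *\<^sub>R x) = \<beta> - 1"
        by simp
      then show False
        using above[OF span_scale[OF x]] by (metis add.commute diff_add_cancel not_one_le_zero
            add_le_same_cancel2 le_diff_eq)
    qed
  qed
qed

section \<open>Balance at a weighted Fermat-Torricelli point\<close>

text \<open>
  If two directions coincided, shifting weight from one vertex to the other would yield a second
  solution with the same sum.
\<close>

lemma inverse_FT_weights_tangents_distinct:
  assumes "inverse_FT_weights u S v" "finite S" "R \<in> S" "R' \<in> S" "R \<noteq> R'"
  shows "u R \<noteq> u R'"
proof
  assume eq: "u R = u R'"
  define v' where "v' = (\<lambda>Q. v Q + (if Q = R then 1 else 0) - (if Q = R' then 1 else 0))"
  have "(\<Sum>Q\<in>S. v' Q) = (\<Sum>Q\<in>S. v Q)"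
    using assms by (simp add: v'_def sum.distrib sum_subtractf)
  moreover have "(\<Sum>Q\<in>S. v' Q *\<^sub>R u Q) = (\<Sum>Q\<in>S. v Q *\<^sub>R u Q)"
  proof -
    have "(\<Sum>Q\<in>S. v' Q *\<^sub>R u Q) = (\<Sum>Q\<in>S. v Q *\<^sub>R u Q + (if Q = R then u Q else 0) - (if Q = R' then u Q else 0))"
      by (intro sum.cong) (auto simp: v'_def algebra_simps)
    also have "\<dots> = (\<Sum>Q\<in>S. v Q *\<^sub>R u Q)"
      using assms eq by (simp add: sum.distrib sum_subtractf)
    finally show ?thesis .
  qed
  ultimately have "v' R = v R"
    using assms unfolding inverse_FT_weights_def by metis
  then show False
    using assms(5) by (simp add: v'_def)
qed

lemma in_span_if_linear_relation:
  fixes x y z :: "'a::real_vector"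
  assumes "a *\<^sub>R x + (b *\<^sub>R y + c *\<^sub>R z) = 0" "a \<noteq> 0"
  shows "x \<in> span {y, z}"
proof -
  have "a *\<^sub>R x = - (b *\<^sub>R y + c *\<^sub>R z)"
    using assms(1) by (simp only: eq_neg_iff_add_eq_0)
  then have "a *\<^sub>R x \<in> span {y, z}"
    by (simp only: span_neg span_add span_scale span_base insertI1 insertI2)
  then show ?thesis
    using assms(2) span_scale[of "a *\<^sub>R x" "{y, z}" "1 / a"] by simp
qed

text \<open>
  Moving from \<open>P\<close> in the direction of the resultant \<open>v\<close> of the weighted tangents would
  decrease the weighted distance sum at least at the rate \<open>v \<bullet> v\<close>, by the first variation
  inequality.
\<close>

lemma weighted_FT_point_balanced:
  fixes G :: "(real^3) set" and V u :: "vertex \<Rightarrow> real^3"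
  assumes G: "convex_body G"
    and n: "n \<noteq> 0" "\<And>y. y \<in> G \<Longrightarrow> n \<bullet> (y - P) \<le> 0" "\<And>R. n \<bullet> u R = 0"
    and g: "\<And>R. shortest_arc (frontier G) P (V R) (g R)" "\<And>R. unit_tangent (g R) (u R)"
    and w: "\<And>R. w R > 0" and FT: "weighted_FT_point (frontier G) V w P"
  shows "(\<Sum>R\<in>{A, B, C, D}. w R *\<^sub>R u R) = 0"
proof -
  let ?I = "{A, B, C, D}"
  have clG: "closed G" "convex G" "interior G \<noteq> {}"
    using G by (auto simp: convex_body_def)
  define v where "v = (\<Sum>R\<in>?I. w R *\<^sub>R u R)"
  define W where "W = (\<Sum>R\<in>?I. w R)"
  have W: "W > 0"
    unfolding W_def by (rule sum_pos) (use w in auto)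
  have nv: "n \<bullet> v = 0"
    using n(3) by (simp add: v_def inner_add_right)
  have "v \<bullet> v \<le> W * \<epsilon>" if \<epsilon>: "\<epsilon> > 0" for \<epsilon>
  proof -
    define x where "x = (\<lambda>t. closest_point G (P + t *\<^sub>R v))"
    have "\<forall>\<^sub>F t in at_right 0. \<forall>R\<in>?I. intrinsic_dist (frontier G) (x t) (V R) < \<infinity> \<and>
      enn2real (intrinsic_dist (frontier G) (x t) (V R))
        \<le> enn2real (path_length (g R)) + t * (\<epsilon> - v \<bullet> u R)"
      unfolding x_def
      by (intro eventually_ball_finite ballI first_variation_le[OF clG n(1,2) g n(3) nv \<epsilon>]) auto
    then obtain b where b: "b > 0" "\<And>t R. 0 < t \<Longrightarrow> t < b \<Longrightarrow> R \<in> ?I \<Longrightarrow>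
        intrinsic_dist (frontier G) (x t) (V R) < \<infinity> \<and>
        enn2real (intrinsic_dist (frontier G) (x t) (V R))
          \<le> enn2real (path_length (g R)) + t * (\<epsilon> - v \<bullet> u R)"
      unfolding eventually_at_right_field by blast
    define t where "t = b / 2"
    have t: "0 < t" "t < b"
      using b by (auto simp: t_def)
    define d where "d R = enn2real (intrinsic_dist (frontier G) (x t) (V R))" for R
    define L where "L R = enn2real (path_length (g R))" for R
    have d: "intrinsic_dist (frontier G) (x t) (V R) = ennreal (d R)" if "R \<in> ?I" for R
      using b(2)[OF t that] by (simp add: d_def less_top)
    have L: "intrinsic_dist (frontier G) P (V R) = ennreal (L R)" for R
      using g(1)[of R] by (metis L_def ennreal_enn2real infinity_ennreal_def shortest_arc_def)
    have dL: "d R \<le> L R + t * (\<epsilon> - v \<bullet> u R)" if "R \<in> ?I" for R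
      using b(2)[OF t that] by (simp add: d_def L_def)
    have xM: "x t \<in> frontier G"
    proof -
      have "P + t *\<^sub>R v \<notin> interior G"
        using interior_below_supporting_plane[OF n(1,2), where z = "P + t *\<^sub>R v"] nv by auto
      then show ?thesis
        using clG interior_subset unfolding x_def
        by (intro closest_point_in_frontier) auto
    qed
    have "(\<Sum>R\<in>?I. ennreal (w R) * ennreal (L R)) \<le> (\<Sum>R\<in>?I. ennreal (w R) * ennreal (d R))"
    proof -
      have "(\<Sum>R\<in>?I. ennreal (w R) * ennreal (L R))
          = (\<Sum>R\<in>?I. ennreal (w R) * intrinsic_dist (frontier G) P (V R))"
        by (simp only: L)
      also have "\<dots> \<le> (\<Sum>R\<in>?I. ennreal (w R) * intrinsic_dist (frontier G) (x t) (V R))"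
        using FT xM unfolding weighted_FT_point_def by blast
      also have "\<dots> = (\<Sum>R\<in>?I. ennreal (w R) * ennreal (d R))"
        by (intro sum.cong refl) (simp only: d)
      finally show ?thesis .
    qed
    then have "ennreal (\<Sum>R\<in>?I. w R * L R) \<le> ennreal (\<Sum>R\<in>?I. w R * d R)"
      using w by (subst (1 2) sum_ennreal[symmetric])
        (auto simp: ennreal_mult less_imp_le L_def d_def simp del: sum.insert)
    then have "(\<Sum>R\<in>?I. w R * L R) \<le> (\<Sum>R\<in>?I. w R * d R)"
      by (subst (asm) ennreal_le_iff) (use w in \<open>auto intro!: sum_nonneg mult_nonneg_nonneg simp: less_imp_le d_def simp del: sum.insert\<close>)
    also have "\<dots> \<le> (\<Sum>R\<in>?I. w R * (L R + t * (\<epsilon> - v \<bullet> u R)))"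
      using w by (intro sum_mono mult_left_mono dL) (auto simp: less_imp_le)
    also have "\<dots> = (\<Sum>R\<in>?I. w R * L R) + t * (W * \<epsilon> - v \<bullet> v)"
      unfolding W_def v_def[symmetric]
      by (subst (3) v_def) (simp add: inner_add_right algebra_simps)
    finally have "0 \<le> t * (W * \<epsilon> - v \<bullet> v)"
      by simp
    then show ?thesis
      using t by (simp add: zero_le_mult_iff)
  qed
  \<comment> \<open>This \<open>\<epsilon>\<close> turns the estimate into \<open>v \<bullet> v \<le> v \<bullet> v / 2\<close>.\<close>
  from this[of "v \<bullet> v / (2 * W)"] have "v \<bullet> v \<le> 0 \<or> v = 0"
    using W by (cases "v = 0") (auto simp: field_simps)
  then have "v = 0"
    by (metis inner_gt_zero_iff not_less)
  then show ?thesis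
    by (simp add: v_def)
qed

section \<open>Solving for the weights\<close>

text \<open>
  The relations between the \<open>u R\<close> with \<open>R \<in> S\<close> form a line, on which a relation is
  determined by the sum of its coefficients.
\<close>

lemma inverse_FT_weights_multiple:
  assumes v: "inverse_FT_weights u S v"
    and x: "(\<Sum>R\<in>S. x R *\<^sub>R u R) = 0" "(\<Sum>R\<in>S. x R) = k * (\<Sum>R\<in>S. v R)" and R: "R \<in> S"
  shows "x R = k * v R"
proof -
  define v' where "v' R = v R + x R - k * v R" for R
  have v0: "(\<Sum>R\<in>S. v R *\<^sub>R u R) = 0"
    using v by (simp add: inverse_FT_weights_def)
  have "(\<Sum>R\<in>S. v' R *\<^sub>R u R) = (\<Sum>R\<in>S. v R *\<^sub>R u R + x R *\<^sub>R u R - k *\<^sub>R (v R *\<^sub>R u R))"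
    by (rule sum.cong) (simp_all add: v'_def scaleR_add_left scaleR_diff_left)
  also have "\<dots> = (\<Sum>R\<in>S. v R *\<^sub>R u R) + (\<Sum>R\<in>S. x R *\<^sub>R u R) - k *\<^sub>R (\<Sum>R\<in>S. v R *\<^sub>R u R)"
    by (simp only: sum.distrib sum_subtractf scaleR_sum_right)
  finally have "(\<Sum>R\<in>S. v' R *\<^sub>R u R) = 0"
    using v0 x(1) by simp
  moreover have "(\<Sum>R\<in>S. v' R) = (\<Sum>R\<in>S. v R)"
  proof -
    have "(\<Sum>R\<in>S. v' R) = (\<Sum>R\<in>S. v R) + (\<Sum>R\<in>S. x R) - k * (\<Sum>R\<in>S. v R)"
      unfolding v'_def by (simp only: sum.distrib sum_subtractf sum_distrib_left)
    then show ?thesis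
      using x(2) by simp
  qed
  ultimately have "v' R = v R"
    using v R unfolding inverse_FT_weights_def by blast
  then show ?thesis
    by (simp add: v'_def)
qed

text \<open>
  Subtracting from the balance of the four vertices the multiple of the relation of
  \<open>{X, Y, W}\<close> that cancels \<open>W\<close> leaves a relation of \<open>{X, Y, Z}\<close>. Since all sums
  of weights agree, its coefficients sum to \<open>(1 - w W / q W) * \<sigma>\<close>, which identifies the
  multiple of \<open>p\<close>.
\<close>

lemma eliminate_fourth_vertex:
  fixes u :: "vertex \<Rightarrow> 'a::real_vector"
  assumes XYZ: "inverse_FT_weights u {X, Y, Z} p" and XYW: "inverse_FT_weights u {X, Y, W} q"
    and dist: "distinct [X, Y, Z, W]" and q: "q W \<noteq> 0"
    and bal: "(\<Sum>R\<in>{X, Y, Z, W}. w R *\<^sub>R u R) = 0"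
    and sums: "(\<Sum>R\<in>{X, Y, Z, W}. w R) = \<sigma>" "(\<Sum>R\<in>{X, Y, Z}. p R) = \<sigma>" "(\<Sum>R\<in>{X, Y, W}. q R) = \<sigma>"
  shows "w X - w W * (q X / q W) = (1 - w W / q W) * p X"
    and "w Z = (1 - w W / q W) * p Z"
proof -
  define m where "m = w W / q W"
  define x where "x = (\<lambda>R. w R - m * q R)(Z := w Z)"
  have mW: "w W = m * q W"
    using q by (simp add: m_def)
  have "(\<Sum>R\<in>{X, Y, W}. q R *\<^sub>R u R) = 0"
    using XYW by (simp add: inverse_FT_weights_def)
  then have "(\<Sum>R\<in>{X, Y, Z, W}. w R *\<^sub>R u R) - m *\<^sub>R (\<Sum>R\<in>{X, Y, W}. q R *\<^sub>R u R) = 0"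
    using bal by (simp only: scaleR_zero_right diff_0_right)
  then have "(\<Sum>R\<in>{X, Y, Z}. x R *\<^sub>R u R) = 0"
    using dist by (simp add: x_def mW algebra_simps)
  moreover have "(\<Sum>R\<in>{X, Y, Z}. x R) = (1 - m) * (\<Sum>R\<in>{X, Y, Z}. p R)"
  proof -
    have "(\<Sum>R\<in>{X, Y, Z}. x R) = (\<Sum>R\<in>{X, Y, Z, W}. w R) - m * (\<Sum>R\<in>{X, Y, W}. q R)"
      using dist by (simp add: x_def mW algebra_simps)
    then show ?thesis
      unfolding sums by (simp add: algebra_simps)
  qed
  ultimately have mult: "x R = (1 - m) * p R" if "R \<in> {X, Y, Z}" for R
    using inverse_FT_weights_multiple[OF XYZ _ _ that] by blast
  have "w X - m * q X = (1 - m) * p X" "w Z = (1 - m) * p Z"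
    using mult[of X] mult[of Z] dist by (simp_all add: x_def)
  then show "w X - w W * (q X / q W) = (1 - w W / q W) * p X" "w Z = (1 - w W / q W) * p Z"
    by (simp_all only: m_def times_divide_eq_left times_divide_eq_right)
qed

text \<open>
  Here \<open>\<alpha>\<close> and \<open>\<alpha>'\<close> are the ratios of the weights at \<open>A\<close> and \<open>D\<close> in
  the triangles \<open>ACD\<close> and \<open>ABD\<close>, and \<open>e\<close>, \<open>e'\<close> are the ratios of the
  weight of the quadrilateral at \<open>D\<close> to those of the two triangles. Both are eliminated
  through the weights at \<open>B\<close> and \<open>C\<close>.
\<close>

lemma solve_for_weights:
  fixes pA pB pC wA wB wC wD \<alpha> \<alpha>' e e' :: real
  assumes nz: "pA \<noteq> 0" "wD \<noteq> 0" "pA + pB + pC \<noteq> 0"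
    and sum: "wA + wB + wC + wD = pA + pB + pC"
    and ACD: "wA - wD * \<alpha> = (1 - e) * pA" "wB = (1 - e) * pB"
    and ABD: "wA - wD * \<alpha>' = (1 - e') * pA" "wC = (1 - e') * pC"
  defines "aA \<equiv> (\<alpha> * (pB / pA) + \<alpha>' * (pC / pA) - 1) / (1 + pB / pA + pC / pA)"
  shows "wA = aA * wD + pA"
    and "wB = (aA * (pB / pA) - \<alpha> * (pB / pA)) * wD + pB"
    and "wC = (aA * (pC / pA) - \<alpha>' * (pC / pA)) * wD + pC"
proof -
  let ?s = "pA + pB + pC"
  have "1 + pB / pA + pC / pA = ?s / pA"
    using nz(1) by (simp add: add_divide_distrib)
  moreover have "\<alpha> * (pB / pA) + \<alpha>' * (pC / pA) - 1 = (\<alpha> * pB + \<alpha>' * pC - pA) / pA"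
    using nz(1) by (simp add: add_divide_distrib diff_divide_distrib)
  ultimately have "aA = (\<alpha> * pB + \<alpha>' * pC - pA) / ?s"
    using nz(1) by (simp add: aA_def)
  then have "aA * ?s = \<alpha> * pB + \<alpha>' * pC - pA"
    using nz(3) by simp
  then have "wD * (aA * ?s) = wD * (\<alpha> * pB + \<alpha>' * pC - pA)"
    by (rule arg_cong)
  then have "aA * wD * ?s = (wD * \<alpha>) * pB + (wD * \<alpha>') * pC - pA * wD"
    by (simp only: algebra_simps)
  also have "\<dots> = (wA - (1 - e) * pA) * pB + (wA - (1 - e') * pA) * pC - pA * (?s - wA - wB - wC)"
  proof -
    have "wD * \<alpha> = wA - (1 - e) * pA" "wD * \<alpha>' = wA - (1 - e') * pA" "wD = ?s - wA - wB - wC"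
      using ACD(1) ABD(1) sum by linarith+
    then show ?thesis by simp
  qed
  also have "\<dots> = (wA - pA) * ?s"
    unfolding ACD(2) ABD(2) by algebra
  finally have a: "aA * wD = wA - pA"
    using nz(3) by simp
  then show "wA = aA * wD + pA"
    by simp
  have "(aA * (p / pA) - \<beta> * (p / pA)) * wD + p = (1 - f) * p"
    if "wA - wD * \<beta> = (1 - f) * pA" for p \<beta> f
  proof -
    have "(aA * (p / pA) - \<beta> * (p / pA)) * wD = (aA * wD - wD * \<beta>) * p / pA"
      by (simp add: algebra_simps diff_divide_distrib)
    also have "aA * wD - wD * \<beta> = - f * pA"
      using a that by (simp add: algebra_simps)
    finally show ?thesis
      using nz(1) by (simp add: algebra_simps)
  qed
  from this[OF ACD(1), of pB] this[OF ABD(1), of pC]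
  show "wB = (aA * (pB / pA) - \<alpha> * (pB / pA)) * wD + pB"
    and "wC = (aA * (pC / pA) - \<alpha>' * (pC / pA)) * wD + pC"
    using ACD(2) ABD(2) by simp_all
qed

theorem corollary1:
  fixes G M Q T :: "(real^3) set" and K1 K2 :: real
    and V u :: "vertex \<Rightarrow> real^3" and P :: "real^3"
    and gAB gBC gCD gDA gCA :: "real \<Rightarrow> real^3"
    and g :: "vertex \<Rightarrow> real \<Rightarrow> real^3"
    and w wABC wABD wACD wBCD :: "vertex \<Rightarrow> real"
  assumes "convex_body G" and "M = frontier G"
    and "bounded_specific_curvature G K1 K2"
    and "convex_quadrilateral M (V A) (V B) (V C) (V D) gAB gBC gCD gDA Q"
    and "path_length gAB + path_length gBC + path_length gCD + path_length gDA
           < ennreal (2 * pi / sqrt K1)"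
    and "geodesic_triangle M (V A) (V B) (V C) gAB gBC gCA T" and "T \<subseteq> Q"
    and "P \<in> (top_of_set M) interior_of Q"
    and "P \<in> (top_of_set M) interior_of T"
    and "\<And>R. shortest_arc M P (V R) (g R)"
    and "\<And>R. unit_tangent (g R) (u R)"
    and "\<And>R. w R > 0" and "weighted_FT_point M V w P"
    and "inverse_FT_weights u {A, B, C} wABC"
    and "inverse_FT_weights u {A, B, D} wABD"
    and "inverse_FT_weights u {A, C, D} wACD"
    and "inverse_FT_weights u {B, C, D} wBCD"
    and "wABC A \<noteq> 0" and "wABD D \<noteq> 0" and "wACD D \<noteq> 0"
    and "(\<Sum>R\<in>{A, B, C, D}. w R) = (\<Sum>R\<in>{A, B, C}. wABC R)"
    and "(\<Sum>R\<in>{A, B, C}. wABC R) = (\<Sum>R\<in>{A, B, D}. wABD R)"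
    and "(\<Sum>R\<in>{A, B, D}. wABD R) = (\<Sum>R\<in>{A, C, D}. wACD R)"
    and "(\<Sum>R\<in>{A, C, D}. wACD R) = (\<Sum>R\<in>{B, C, D}. wBCD R)"
  shows
    "let aA = ((wACD A / wACD D) * (wABC B / wABC A)
                 + (wABD A / wABD D) * (wABC C / wABC A) - 1)
              / (1 + wABC B / wABC A + wABC C / wABC A);
         aB = aA * (wABC B / wABC A) - (wACD A / wACD D) * (wABC B / wABC A);
         aC = aA * (wABC C / wABC A) - (wABD A / wABD D) * (wABC C / wABC A);
         bA = wABC A; bB = wABC B; bC = wABC C
     in w A = aA * w D + bA \<and> w B = aB * w D + bB \<and> w C = aC * w D + bC"
proof -
  note convex = \<open>convex_body G\<close>
  have frontier: "M = frontier G"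
    by fact
  have arcs: "\<And>R. shortest_arc (frontier G) P (V R) (g R)" and tangent: "\<And>R. unit_tangent (g R) (u R)"
    using assms(10,11) frontier by auto
  have PM: "P \<in> frontier G"
    using assms(13) frontier by (simp add: weighted_FT_point_def)
  have relABC: "wABC A *\<^sub>R u A + (wABC B *\<^sub>R u B + wABC C *\<^sub>R u C) = 0"
    using assms(14) by (simp add: inverse_FT_weights_def)
  have relABD: "wABD D *\<^sub>R u D + (wABD A *\<^sub>R u A + wABD B *\<^sub>R u B) = 0"
    using assms(15) by (simp add: inverse_FT_weights_def algebra_simps)
  \<comment> \<open>The relation for \<open>ABC\<close> puts three tangents in a plane; the nonzero coefficient at
    \<open>D\<close> in the relation for \<open>ABD\<close> puts the fourth in the same plane.\<close>
  have A: "u A \<in> span {u B, u C}"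
    by (rule in_span_if_linear_relation[OF relABC]) fact
  have "u D \<in> span {u A, u B}"
    by (rule in_span_if_linear_relation[OF relABD]) fact
  moreover have "span {u A, u B} \<subseteq> span {u B, u C}"
    by (intro span_minimal subspace_span) (use A in \<open>auto simp: span_base\<close>)
  ultimately have "u R \<in> span {u B, u C}" for R
    using A by (cases R) (auto simp: span_base)
  then have "span (range u) \<subseteq> span {u B, u C}"
    by (intro span_minimal subspace_span) auto
  then have "dim (span (range u)) \<le> card {u B, u C}"
    by (intro dim_le_card) auto
  also have "\<dots> \<le> 2"
    by (simp add: card_insert_if)
  finally have plane: "dim (span (range u)) \<le> 2" .
  have distinct: "u A \<noteq> u B" "u A \<noteq> u C" "u B \<noteq> u C"
    using inverse_FT_weights_tangents_distinct[OF assms(14)] by auto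
  obtain n where n: "n \<noteq> 0" "\<And>y. y \<in> G \<Longrightarrow> n \<bullet> (y - P) \<le> 0" "\<And>x. x \<in> span (range u) \<Longrightarrow> n \<bullet> x = 0"
  proof (rule supporting_normal_orthogonal_to_tangents[of G P UNIV g u A B C])
    show "closed G" "convex G" "interior G \<noteq> {}"
      using convex by (auto simp: convex_body_def)
    show "inj_on (g R) {0..1}" "g R 0 = P" "path_image (g R) \<subseteq> frontier G" "path (g R)" for R
      using arcs[of R] by (auto simp: shortest_arc_def arc_def pathstart_def)
  qed (use PM tangent plane distinct in auto)
  have balance: "(\<Sum>R\<in>{A, B, C, D}. w R *\<^sub>R u R) = 0"
  proof (rule weighted_FT_point_balanced[OF convex n(1,2) _ arcs tangent assms(12)])
    show "n \<bullet> u R = 0" for R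
      by (rule n(3)) (simp add: span_base)
    show "weighted_FT_point (frontier G) V w P"
      using assms(13) unfolding frontier .
  qed
  have sumABD: "(\<Sum>R\<in>{A, B, D}. wABD R) = (\<Sum>R\<in>{A, B, C, D}. w R)"
    by (rule trans[OF assms(22)[symmetric] assms(21)[symmetric]])
  have sumACD: "(\<Sum>R\<in>{A, C, D}. wACD R) = (\<Sum>R\<in>{A, B, C, D}. w R)"
    by (rule trans[OF assms(23)[symmetric] sumABD])
  have perm: "{A, C, B} = {A, B, C}" "{A, C, B, D} = {A, B, C, D}"
    by auto
  have ACD: "w A - w D * (wACD A / wACD D) = (1 - w D / wACD D) * wABC A"
      "w B = (1 - w D / wACD D) * wABC B"
    by (rule eliminate_fourth_vertex[of u A C B wABC D wACD w, unfolded perm,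
        OF assms(14,16) _ assms(20) balance refl assms(21)[symmetric] sumACD], simp)+
  have ABD: "w A - w D * (wABD A / wABD D) = (1 - w D / wABD D) * wABC A"
      "w C = (1 - w D / wABD D) * wABC C"
    by (rule eliminate_fourth_vertex[of u A B C wABC D wABD w,
        OF assms(14,15) _ assms(19) balance refl assms(21)[symmetric] sumABD], simp)+
  have sum: "w A + w B + w C + w D = wABC A + wABC B + wABC C"
    using assms(21) by simp
  then have sum_nz: "wABC A + wABC B + wABC C \<noteq> 0"
    using assms(12)[of A] assms(12)[of B] assms(12)[of C] assms(12)[of D] by linarith
  have "w D \<noteq> 0"
    using assms(12)[of D] by simp
  show ?thesis
    unfolding Let_def by (intro conjI) (rule solve_for_weights[OF assms(18) \<open>w D \<noteq> 0\<close> sum_nz sum ACD ABD])+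
qed

end
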